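(* For each $m\in\mathbb{N}$ with $m>1$, there is a right $D_{m^2}$-module map $T\colon M_{m,m^2}\to M_{m,m^2}$ with $$\sqrt m=\|T\|<\|T_{m,1}\|=\|T\|_{cb}=m.$$ Hence $C(m,m^2)=\sqrt m$.
   Context: $M_{m,n}$ is the space of $m\times n$ complex matrices with the operator norm, i.e. $M_{m,n}=\mathcal{B}(\mathbb{C}^n,\mathbb{C}^m)$ where $\mathbb{C}^n,\mathbb{C}^m$ carry the $\ell^2$ norm. $D_n\subseteq M_{n,n}$ is the algebra of diagonal $n\times n$ matrices. A right $D_n$-module map on $M_{m,n}$ is a linear map $T\colon M_{m,n}\to M_{m,n}$ with $T(xd)=T(x)d$ for all $x\in M_{m,n}$, $d\in D_n$. For $s,t\in\mathbb{N}$, $M_{s,t}(M_{m,n})$ (the $s\times t$ matrices with entries in $M_{m,n}$) is identified with $M_{sm,tn}$ and carries the operator norm of that space; the ampliation $T_{s,t}$ is the map $T_{s,t}[x_{ij}]=[Tx_{ij}]$ on $M_{s,t}(M_{m,n})$. $\|T\|=\sup\{\|Tx\|\colon \|x\|\le1\}$, $\|T_{s,t}\|$ is defined likewise, and $\|T\|_{cb}=\sup_{s,t\ge1}\|T_{s,t}\|$. Finally $C(m,n)=\sup\{\|T\|_{cb}\colon T \text{ a right } D_n\text{-module map on } M_{m,n},\ \|T\|\le1\}$. *)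

theory Defs
  imports
    "Jordan_Normal_Form.Matrix"
    "HOL-Analysis.L2_Norm"
    "HOL-Library.Extended_Nonnegative_Real"
begin

text \<open>
  \<open>M\<^sub>m\<^sub>,\<^sub>n\<close> is \<open>carrier_mat m n\<close> over the complex numbers. All norms that are
  defined as suprema are taken in \<open>[0, \<infinity>]\<close>, so that no supremum is a junk value.
\<close>

definition l2_norm_vec :: "complex vec \<Rightarrow> real" where
  "l2_norm_vec v = L2_set (\<lambda>i. cmod (v $ i)) {..<dim_vec v}"

definition op_norm :: "complex mat \<Rightarrow> ennreal" where
  "op_norm A =
     (SUP v \<in> {v \<in> carrier_vec (dim_col A). l2_norm_vec v \<le> 1}.
        ennreal (l2_norm_vec (A *\<^sub>v v)))"

definition diag_algebra :: "nat \<Rightarrow> complex mat set" where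
  "diag_algebra n = {d \<in> carrier_mat n n. diagonal_mat d}"

text \<open>
  Maps on \<open>M\<^sub>m\<^sub>,\<^sub>n\<close> are total functions on the type of matrices, of which only
  the values on \<open>carrier_mat m n\<close> matter.
\<close>

definition right_diag_module_map ::
  "nat \<Rightarrow> nat \<Rightarrow> (complex mat \<Rightarrow> complex mat) \<Rightarrow> bool" where
  "right_diag_module_map m n T \<longleftrightarrow>
     (\<forall>x \<in> carrier_mat m n. T x \<in> carrier_mat m n) \<and>
     (\<forall>x \<in> carrier_mat m n. \<forall>y \<in> carrier_mat m n. T (x + y) = T x + T y) \<and>
     (\<forall>c. \<forall>x \<in> carrier_mat m n. T (c \<cdot>\<^sub>m x) = c \<cdot>\<^sub>m T x) \<and>
     (\<forall>x \<in> carrier_mat m n. \<forall>d \<in> diag_algebra n. T (x * d) = T x * d)"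

definition map_norm :: "nat \<Rightarrow> nat \<Rightarrow> (complex mat \<Rightarrow> complex mat) \<Rightarrow> ennreal" where
  "map_norm m n T = (SUP x \<in> {x \<in> carrier_mat m n. op_norm x \<le> 1}. op_norm (T x))"

text \<open>
  The identification of \<open>M\<^sub>s\<^sub>,\<^sub>t(M\<^sub>m\<^sub>,\<^sub>n)\<close> with the \<open>s m \<times> t n\<close> matrices:
  \<open>mat_block m n X i j\<close> is the \<open>m \<times> n\<close> entry in block position \<open>(i, j)\<close>,
  where \<open>i < s\<close> and \<open>j < t\<close>.
\<close>

definition mat_block :: "nat \<Rightarrow> nat \<Rightarrow> complex mat \<Rightarrow> nat \<Rightarrow> nat \<Rightarrow> complex mat" where
  "mat_block m n X i j = mat m n (\<lambda>(p, q). X $$ (i * m + p, j * n + q))"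

definition ampliation ::
  "nat \<Rightarrow> nat \<Rightarrow> nat \<Rightarrow> nat \<Rightarrow> (complex mat \<Rightarrow> complex mat) \<Rightarrow> complex mat \<Rightarrow> complex mat" where
  "ampliation m n s t T X =
     mat (s * m) (t * n)
       (\<lambda>(p, q). T (mat_block m n X (p div m) (q div n)) $$ (p mod m, q mod n))"

definition ampliation_norm ::
  "nat \<Rightarrow> nat \<Rightarrow> nat \<Rightarrow> nat \<Rightarrow> (complex mat \<Rightarrow> complex mat) \<Rightarrow> ennreal" where
  "ampliation_norm m n s t T = map_norm (s * m) (t * n) (ampliation m n s t T)"

definition cb_norm :: "nat \<Rightarrow> nat \<Rightarrow> (complex mat \<Rightarrow> complex mat) \<Rightarrow> ennreal" where
  "cb_norm m n T = (SUP s \<in> {1..}. SUP t \<in> {1..}. ampliation_norm m n s t T)"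

definition C_const :: "nat \<Rightarrow> nat \<Rightarrow> ennreal" where
  "C_const m n =
     (SUP T \<in> {T. right_diag_module_map m n T \<and> map_norm m n T \<le> 1}. cb_norm m n T)"

end

theory Submission
  imports Defs "HOL-Number_Theory.Cong"
begin

text \<open>
  A right module map over the diagonal matrices acts on the columns of \<open>x\<close> separately, so it is
  given by matrices \<open>A\<^sub>j\<close>, with \<open>j < n\<close>, through \<open>[x\<^sub>j] \<mapsto> [A\<^sub>j x\<^sub>j]\<close>
  (\<open>right_diag_module_map_imp_column_map\<close>).

  For the upper bound \<open>\<parallel>T\<parallel>\<^sub>c\<^sub>b \<le> \<surd>m \<parallel>T\<parallel>\<close>, take a contraction \<open>X\<close> and a unit vector \<open>v\<close>, and cut
  the vector \<open>T\<^sub>s\<^sub>,\<^sub>t(X) v\<close>, which lies in \<open>\<complex>\<^sup>s \<otimes> \<complex>\<^sup>m\<close>, into its \<open>m\<close> slices in \<open>\<complex>\<^sup>s\<close>. The norm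
  of slice \<open>p\<close> is attained by pairing with a unit vector \<open>c\<close>; this pairing equals coordinate \<open>p\<close> of
  \<open>T(x) \<rho>\<close>, where \<open>x\<close> is the compression of \<open>X\<close> to an \<open>m \<times> n\<close> contraction by \<open>c\<close> and by a
  partial isometry built from \<open>v\<close>, and \<open>\<rho>\<close> is again a unit vector. Hence each of the \<open>m\<close> slices has norm at
  most \<open>\<parallel>T\<parallel>\<close> (\<open>ampliation_row_slice_le\<close>), and adding the squares gives the factor \<open>\<surd>m\<close>.

  For the extremal map, let the \<open>A\<^sub>j\<close> be the \<open>m\<^sup>2\<close> Weyl unitaries \<open>U\<^sub>j\<close>, which are orthogonal for
  the trace inner product. Since the \<open>U\<^sub>j\<close> are isometric, \<open>T\<close> preserves the Hilbert-Schmidt norm,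
  which is at most \<open>\<surd>m\<close> for a contraction with \<open>m\<close> rows; so \<open>\<parallel>T\<parallel> \<le> \<surd>m\<close>. On the other hand let
  \<open>\<Omega>\<close> be the maximally entangled unit vector of \<open>\<complex>\<^sup>m \<otimes> \<complex>\<^sup>m\<close>. The vectors
  \<open>(I \<otimes> U\<^sub>j\<^sup>*) \<Omega>\<close> form an orthonormal basis, so the matrix with these columns is unitary, while
  \<open>T\<^sub>m\<^sub>,\<^sub>1\<close> sends it to the matrix all of whose \<open>m\<^sup>2\<close> columns are \<open>\<Omega>\<close>, of norm \<open>m\<close>. Together
  with the upper bound this forces \<open>\<parallel>T\<parallel> = \<surd>m\<close> and \<open>\<parallel>T\<parallel>\<^sub>c\<^sub>b = m\<close>, and dividing \<open>T\<close> by \<open>\<surd>m\<close> shows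
  that the upper bound is the value of \<open>C(m, m\<^sup>2)\<close>.
\<close>

section \<open>Euclidean norm and operator norm\<close>

lemma l2_norm_vec_nonneg: "0 \<le> l2_norm_vec v"
  by (simp add: l2_norm_vec_def)

lemma l2_norm_vec_square:
  assumes "v \<in> carrier_vec n"
  shows "(l2_norm_vec v)\<^sup>2 = (\<Sum>i<n. (cmod (v $ i))\<^sup>2)"
  using assms by (auto simp: l2_norm_vec_def L2_set_def sum_nonneg)

lemma cmod_component_le_l2_norm_vec:
  assumes "v \<in> carrier_vec n" "i < n"
  shows "cmod (v $ i) \<le> l2_norm_vec v"
  using assms unfolding l2_norm_vec_def by (intro member_le_L2_set) auto

lemma l2_norm_vec_smult: "l2_norm_vec (c \<cdot>\<^sub>v v) = cmod c * l2_norm_vec v"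
proof -
  have "L2_set (\<lambda>i. cmod ((c \<cdot>\<^sub>v v) $ i)) {..<dim_vec v} = L2_set (\<lambda>i. cmod c * cmod (v $ i)) {..<dim_vec v}"
    by (intro L2_set_cong) (auto simp: norm_mult)
  then show ?thesis
    by (simp add: l2_norm_vec_def L2_set_right_distrib)
qed

lemma l2_norm_vec_eq_0_iff:
  assumes "v \<in> carrier_vec n"
  shows "l2_norm_vec v = 0 \<longleftrightarrow> v = 0\<^sub>v n"
  using assms by (auto simp: l2_norm_vec_def L2_set_eq_0_iff)

lemma index_mult_mat_vec_sum:
  fixes M :: "'a :: semiring_0 mat"
  assumes "M \<in> carrier_mat a b" "v \<in> carrier_vec b" "i < a"
  shows "(M *\<^sub>v v) $ i = (\<Sum>j<b. M $$ (i, j) * v $ j)"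
  using assms by (auto simp: scalar_prod_def lessThan_atLeast0 intro!: sum.cong)

lemma cmod_sum_Cauchy_Schwarz:
  "(cmod (\<Sum>i\<in>S. f i * g i))\<^sup>2 \<le> (\<Sum>i\<in>S. (cmod (f i))\<^sup>2) * (\<Sum>i\<in>S. (cmod (g i))\<^sup>2)"
proof -
  have "cmod (\<Sum>i\<in>S. f i * g i) \<le> (\<Sum>i\<in>S. \<bar>cmod (f i)\<bar> * \<bar>cmod (g i)\<bar>)"
    by (rule order.trans[OF norm_sum]) (simp add: norm_mult)
  also have "\<dots> \<le> L2_set (\<lambda>i. cmod (f i)) S * L2_set (\<lambda>i. cmod (g i)) S"
    by (rule L2_set_mult_ineq)
  finally have "(cmod (\<Sum>i\<in>S. f i * g i))\<^sup>2
      \<le> (L2_set (\<lambda>i. cmod (f i)) S * L2_set (\<lambda>i. cmod (g i)) S)\<^sup>2"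
    by (intro power_mono) auto
  then show ?thesis
    by (simp add: L2_set_def power_mult_distrib sum_nonneg)
qed

text \<open>
  Passes from the extended-real supremum to real inequalities for individual vectors, the form in
  which all the estimates below are made.
\<close>

lemma op_norm_le_iff:
  assumes M: "M \<in> carrier_mat a b" and c: "0 \<le> c"
  shows "op_norm M \<le> ennreal c \<longleftrightarrow>
    (\<forall>v\<in>carrier_vec b. l2_norm_vec (M *\<^sub>v v) \<le> c * l2_norm_vec v)"
proof
  assume le: "op_norm M \<le> ennreal c"
  show "\<forall>v\<in>carrier_vec b. l2_norm_vec (M *\<^sub>v v) \<le> c * l2_norm_vec v"
  proof
    fix v :: "complex vec" assume v: "v \<in> carrier_vec b"
    show "l2_norm_vec (M *\<^sub>v v) \<le> c * l2_norm_vec v"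
    proof (cases "l2_norm_vec v = 0")
      case True
      then have "v = 0\<^sub>v b" using v by (simp add: l2_norm_vec_eq_0_iff)
      then have "M *\<^sub>v v = 0\<^sub>v a" using M by auto
      then show ?thesis using True l2_norm_vec_eq_0_iff[of "0\<^sub>v a" a] by simp
    next
      case False
      then have pos: "l2_norm_vec v > 0" using l2_norm_vec_nonneg[of v] by simp
      define u where "u = complex_of_real (1 / l2_norm_vec v) \<cdot>\<^sub>v v"
      have u: "u \<in> carrier_vec b" using v by (simp add: u_def)
      have "l2_norm_vec u \<le> 1"
        unfolding u_def l2_norm_vec_smult using pos by (simp add: norm_divide)
      then have "ennreal (l2_norm_vec (M *\<^sub>v u)) \<le> op_norm M"
        unfolding op_norm_def using u M by (intro SUP_upper) auto
      then have "l2_norm_vec (M *\<^sub>v u) \<le> c"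
        using le c by (metis ennreal_le_iff order.trans)
      moreover have "l2_norm_vec (M *\<^sub>v u) = l2_norm_vec (M *\<^sub>v v) / l2_norm_vec v"
        unfolding u_def mult_mat_vec[OF M v] l2_norm_vec_smult using pos by (simp add: norm_divide)
      ultimately show ?thesis using pos by (simp add: field_simps)
    qed
  qed
next
  assume *: "\<forall>v\<in>carrier_vec b. l2_norm_vec (M *\<^sub>v v) \<le> c * l2_norm_vec v"
  show "op_norm M \<le> ennreal c"
    unfolding op_norm_def
  proof (rule SUP_least)
    fix v assume v: "v \<in> {v \<in> carrier_vec (dim_col M). l2_norm_vec v \<le> 1}"
    then have "l2_norm_vec (M *\<^sub>v v) \<le> c * l2_norm_vec v" using * M by auto
    also have "\<dots> \<le> c * 1" using v c by (intro mult_left_mono) auto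
    finally show "ennreal (l2_norm_vec (M *\<^sub>v v)) \<le> ennreal c"
      by (simp add: ennreal_leI)
  qed
qed

lemma contraction_iff:
  assumes "M \<in> carrier_mat a b"
  shows "op_norm M \<le> 1 \<longleftrightarrow> (\<forall>v\<in>carrier_vec b. l2_norm_vec (M *\<^sub>v v) \<le> l2_norm_vec v)"
  using op_norm_le_iff[OF assms, of 1] by simp

lemma map_norm_leD:
  assumes le: "map_norm m n T \<le> ennreal K" and K: "0 \<le> K"
    and x: "x \<in> carrier_mat m n" "op_norm x \<le> 1"
    and Tx: "T x \<in> carrier_mat m n" and v: "v \<in> carrier_vec n"
  shows "l2_norm_vec (T x *\<^sub>v v) \<le> K * l2_norm_vec v"
proof -
  have "op_norm (T x) \<le> map_norm m n T"
    unfolding map_norm_def using x by (intro SUP_upper) auto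
  then show ?thesis using op_norm_le_iff[OF Tx K] le v by (meson order.trans)
qed

text \<open>
  Apply \<open>x\<close> to the conjugate of its \<open>i\<close>-th row: coordinate \<open>i\<close> of the result is the squared norm
  of that row.
\<close>

lemma contraction_row_le_1:
  assumes x: "x \<in> carrier_mat m n" "op_norm x \<le> 1" and i: "i < m"
  shows "(\<Sum>j<n. (cmod (x $$ (i, j)))\<^sup>2) \<le> 1"
proof -
  define R where "R = (\<Sum>j<n. (cmod (x $$ (i, j)))\<^sup>2)"
  define v where "v = vec n (\<lambda>j. cnj (x $$ (i, j)))"
  have v: "v \<in> carrier_vec n" by (simp add: v_def)
  have R: "0 \<le> R" by (simp add: R_def sum_nonneg)
  have sq: "(l2_norm_vec v)\<^sup>2 = R"
    unfolding l2_norm_vec_square[OF v] by (simp add: v_def R_def)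
  have "(x *\<^sub>v v) $ i = complex_of_real R"
    unfolding index_mult_mat_vec_sum[OF x(1) v i]
    by (simp add: v_def R_def complex_norm_square del: of_real_power)
  then have "R \<le> l2_norm_vec (x *\<^sub>v v)"
    using cmod_component_le_l2_norm_vec[OF mult_mat_vec_carrier[OF x(1) v] i] R by simp
  also have "\<dots> \<le> l2_norm_vec v" using x v by (simp add: contraction_iff)
  finally have "R\<^sup>2 \<le> R"
    using R sq by (metis power_mono)
  then show ?thesis unfolding R_def[symmetric]
    using R by (cases "R = 0") (auto simp: power2_eq_square)
qed

lemma contraction_of_orthonormal_cols:
  assumes M: "M \<in> carrier_mat a b"
    and orth: "\<And>j j'. j < b \<Longrightarrow> j' < b \<Longrightarrow>
      (\<Sum>r<a. M $$ (r, j) * cnj (M $$ (r, j'))) = (if j = j' then 1 else 0)"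
  shows "op_norm M \<le> 1"
  unfolding contraction_iff[OF M]
proof
  fix v :: "complex vec" assume v: "v \<in> carrier_vec b"
  have Mv: "M *\<^sub>v v \<in> carrier_vec a" using M v by simp
  have "complex_of_real ((l2_norm_vec (M *\<^sub>v v))\<^sup>2)
      = (\<Sum>r<a. (\<Sum>j<b. M $$ (r, j) * v $ j) * cnj (\<Sum>j'<b. M $$ (r, j') * v $ j'))"
    unfolding l2_norm_vec_square[OF Mv]
    by (simp add: index_mult_mat_vec_sum[OF M v] complex_norm_square del: of_real_power)
  also have "\<dots> = (\<Sum>r<a. \<Sum>j<b. \<Sum>j'<b. v $ j * cnj (v $ j') * (M $$ (r, j) * cnj (M $$ (r, j'))))"
    by (simp add: sum_product algebra_simps)
  also have "\<dots> = (\<Sum>j<b. \<Sum>r<a. \<Sum>j'<b. v $ j * cnj (v $ j') * (M $$ (r, j) * cnj (M $$ (r, j'))))"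
    by (rule sum.swap)
  also have "\<dots> = (\<Sum>j<b. \<Sum>j'<b. v $ j * cnj (v $ j') * (\<Sum>r<a. M $$ (r, j) * cnj (M $$ (r, j'))))"
    unfolding sum_distrib_left by (rule sum.cong[OF refl], rule sum.swap)
  also have "\<dots> = (\<Sum>j<b. \<Sum>j'<b. if j = j' then v $ j * cnj (v $ j') else 0)"
    by (intro sum.cong refl) (simp add: orth)
  also have "\<dots> = (\<Sum>j<b. v $ j * cnj (v $ j))"
    by (intro sum.cong refl) simp
  also have "\<dots> = complex_of_real ((l2_norm_vec v)\<^sup>2)"
    unfolding l2_norm_vec_square[OF v]
    by (simp add: complex_norm_square del: of_real_power)
  finally have "(l2_norm_vec (M *\<^sub>v v))\<^sup>2 = (l2_norm_vec v)\<^sup>2"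
    using of_real_eq_iff by blast
  then show "l2_norm_vec (M *\<^sub>v v) \<le> l2_norm_vec v"
    using l2_norm_vec_nonneg by simp
qed

section \<open>Module maps act on columns\<close>

lemma sum_lessThan_mult:
  fixes f :: "nat \<Rightarrow> 'a :: comm_monoid_add"
  shows "(\<Sum>r<s * m. f r) = (\<Sum>i<s. \<Sum>p<m. f (i * m + p))"
proof -
  have "(\<Sum>p<m. f (i * m + p)) = sum f {i * m..<i * m + m}" for i
    using sum.shift_bounds_nat_ivl[of f 0 "i * m" m]
    by (simp add: lessThan_atLeast0 add.commute)
  then show ?thesis by (simp add: sum.nat_group)
qed

lemma block_index_less: "(i :: nat) < s \<Longrightarrow> p < m \<Longrightarrow> i * m + p < s * m"
  by (metis add.commute add_less_cancel_left less_le_trans mult_Suc mult_le_mono1 Suc_leI)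

definition column_map ::
  "nat \<Rightarrow> nat \<Rightarrow> (nat \<Rightarrow> nat \<Rightarrow> nat \<Rightarrow> complex) \<Rightarrow> complex mat \<Rightarrow> complex mat" where
  "column_map m n A x = mat m n (\<lambda>(i, j). \<Sum>q<m. A j i q * x $$ (q, j))"

lemma column_map_carrier [simp]: "column_map m n A x \<in> carrier_mat m n"
  by (simp add: column_map_def)

lemma index_mult_diag:
  fixes x :: "complex mat"
  assumes x: "x \<in> carrier_mat m n" and d: "d \<in> diag_algebra n" and i: "i < m" and j: "j < n"
  shows "(x * d) $$ (i, j) = x $$ (i, j) * d $$ (j, j)"
proof -
  have dc: "d \<in> carrier_mat n n" and dd: "\<And>k. k < n \<Longrightarrow> k \<noteq> j \<Longrightarrow> d $$ (k, j) = 0"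
    using d j by (auto simp: diag_algebra_def diagonal_mat_def)
  have "(x * d) $$ (i, j) = (\<Sum>k<n. x $$ (i, k) * d $$ (k, j))"
    using x dc i j by (auto simp: scalar_prod_def lessThan_atLeast0 intro!: sum.cong)
  also have "\<dots> = (\<Sum>k<n. if k = j then x $$ (i, j) * d $$ (j, j) else 0)"
    by (intro sum.cong refl) (auto simp: dd)
  finally show ?thesis using j by simp
qed

lemma right_diag_module_map_column_map: "right_diag_module_map m n (column_map m n A)"
  unfolding right_diag_module_map_def
proof (intro conjI ballI allI)
  fix x y :: "complex mat" assume x: "x \<in> carrier_mat m n" and y: "y \<in> carrier_mat m n"
  show "column_map m n A (x + y) = column_map m n A x + column_map m n A y"
    using x y by (intro eq_matI) (auto simp: column_map_def algebra_simps sum.distrib)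
next
  fix c and x :: "complex mat" assume x: "x \<in> carrier_mat m n"
  show "column_map m n A (c \<cdot>\<^sub>m x) = c \<cdot>\<^sub>m column_map m n A x"
    using x by (intro eq_matI) (auto simp: column_map_def algebra_simps sum_distrib_left)
next
  fix x d :: "complex mat" assume x: "x \<in> carrier_mat m n" and d: "d \<in> diag_algebra n"
  have dc: "d \<in> carrier_mat n n" using d by (simp add: diag_algebra_def)
  show "column_map m n A (x * d) = column_map m n A x * d"
  proof (rule eq_matI)
    fix i j assume "i < dim_row (column_map m n A x * d)" "j < dim_col (column_map m n A x * d)"
    then have i: "i < m" and j: "j < n" using dc by (auto simp: column_map_def)
    show "column_map m n A (x * d) $$ (i, j) = (column_map m n A x * d) $$ (i, j)"
      unfolding index_mult_diag[OF column_map_carrier d i j]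
      using i j by (simp add: column_map_def index_mult_diag[OF x d] sum_distrib_right mult.assoc
          del: index_mult_mat)
  qed (use dc in \<open>auto simp: column_map_def\<close>)
qed simp

text \<open>
  Multiplying on the right by the diagonal unit with entry \<open>1\<close> at \<open>j\<close> isolates column \<open>j\<close>, so
  column \<open>j\<close> of \<open>T x\<close> depends only on column \<open>j\<close> of \<open>x\<close>, and does so linearly.
\<close>

lemma right_diag_module_map_imp_column_map:
  assumes T: "right_diag_module_map m n T"
  obtains A where "\<And>x. x \<in> carrier_mat m n \<Longrightarrow> T x = column_map m n A x"
proof
  define E where "E j q = mat m n (\<lambda>(i, k). if i = q \<and> k = j then 1 else 0 :: complex)" for j q
  define A where "A j i q = T (E j q) $$ (i, j)" for j i q
  have Tc: "T x \<in> carrier_mat m n" if "x \<in> carrier_mat m n" for x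
    using T that by (auto simp: right_diag_module_map_def)
  have Tadd: "T (x + y) = T x + T y" if "x \<in> carrier_mat m n" "y \<in> carrier_mat m n" for x y
    using T that by (auto simp: right_diag_module_map_def)
  have Tsmult: "T (c \<cdot>\<^sub>m x) = c \<cdot>\<^sub>m T x" if "x \<in> carrier_mat m n" for c x
    using T that by (auto simp: right_diag_module_map_def)
  have Tdiag: "T (x * d) = T x * d" if "x \<in> carrier_mat m n" "d \<in> diag_algebra n" for d x
    using T that by (auto simp: right_diag_module_map_def)
  fix x :: "complex mat" assume x: "x \<in> carrier_mat m n"
  \<comment> \<open>The first \<open>k\<close> entries of column \<open>j\<close>: additivity of \<open>T\<close> is used one entry at a time.\<close>
  define trunc where "trunc j k = mat m n (\<lambda>(q, l). if l = j \<and> q < k then x $$ (q, j) else 0)" for j k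
  have trunc: "T (trunc j k) $$ (i, j) = (\<Sum>q<k. A j i q * x $$ (q, j))"
    if i: "i < m" and j: "j < n" and "k \<le> m" for i j k
    using \<open>k \<le> m\<close>
  proof (induction k)
    case 0
    have zero: "0 \<cdot>\<^sub>m trunc j 0 = trunc j 0" by (rule eq_matI) (auto simp: trunc_def)
    have trunc0: "trunc j 0 \<in> carrier_mat m n" by (simp add: trunc_def)
    have "T (trunc j 0) = 0 \<cdot>\<^sub>m T (trunc j 0)"
      using Tsmult[OF trunc0, of 0] unfolding zero .
    then have "T (trunc j 0) $$ (i, j) = (0 \<cdot>\<^sub>m T (trunc j 0)) $$ (i, j)"
      by (rule arg_cong)
    also have "\<dots> = 0" using Tc[OF trunc0] i j by simp
    finally show ?case by simp
  next
    case (Suc k)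
    have "trunc j (Suc k) = trunc j k + x $$ (k, j) \<cdot>\<^sub>m E j k"
      by (rule eq_matI) (auto simp: trunc_def E_def less_Suc_eq)
    then have "T (trunc j (Suc k)) = T (trunc j k) + x $$ (k, j) \<cdot>\<^sub>m T (E j k)"
      by (simp add: Tadd Tsmult trunc_def E_def)
    then have "T (trunc j (Suc k)) $$ (i, j) = T (trunc j k) $$ (i, j) + x $$ (k, j) * A j i k"
      using Tc[of "E j k"] i j by (simp add: A_def E_def)
    then show ?case using Suc by (simp add: mult.commute)
  qed
  show "T x = column_map m n A x"
  proof (rule eq_matI)
    fix i j assume "i < dim_row (column_map m n A x)" "j < dim_col (column_map m n A x)"
    then have i: "i < m" and j: "j < n" by (auto simp: column_map_def)
    define d where "d = mat n n (\<lambda>(k, l). if k = j \<and> l = j then 1 else 0 :: complex)"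
    have d: "d \<in> diag_algebra n" by (auto simp: d_def diag_algebra_def diagonal_mat_def)
    have "x * d = trunc j m"
    proof (rule eq_matI)
      fix i' j' assume "i' < dim_row (trunc j m)" "j' < dim_col (trunc j m)"
      then have "i' < m" "j' < n" by (auto simp: trunc_def)
      then show "(x * d) $$ (i', j') = trunc j m $$ (i', j')"
        unfolding index_mult_diag[OF x d \<open>i' < m\<close> \<open>j' < n\<close>] by (auto simp: d_def trunc_def)
    qed (use x d in \<open>auto simp: trunc_def diag_algebra_def\<close>)
    then have "T (trunc j m) $$ (i, j) = T x $$ (i, j)"
      using Tdiag[OF x d] index_mult_diag[OF Tc[OF x] d i j] j by (simp add: d_def)
    then show "T x $$ (i, j) = column_map m n A x $$ (i, j)"
      using trunc[OF i j order.refl] i j by (simp add: column_map_def)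
  qed (use Tc[OF x] in \<open>auto simp: column_map_def\<close>)
qed

section \<open>The upper bound for the completely bounded norm\<close>

lemma index_ampliation:
  assumes "i < s" "p < m" "k < t" "j < n"
    and T: "\<And>x. x \<in> carrier_mat m n \<Longrightarrow> T x = column_map m n A x"
  shows "ampliation m n s t T X $$ (i * m + p, k * n + j)
    = (\<Sum>q<m. A j p q * X $$ (i * m + q, k * n + j))"
proof -
  have "T (mat_block m n X i k) = column_map m n A (mat_block m n X i k)"
    by (rule T) (simp add: mat_block_def)
  then show ?thesis using assms(1-4) block_index_less
    by (simp add: ampliation_def column_map_def mat_block_def)
qed

text \<open>
  The sum is the squared norm of slice \<open>p\<close>. The map \<open>x \<mapsto> e\<^sub>p\<^sup>* T(x)\<close> takes values in row matrices,
  and for such maps an ampliation does not increase the norm: the slice is tested against one unit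
  vector of \<open>\<complex>\<^sup>s\<close>, and this vector and \<open>v\<close> can be moved inside \<open>T\<close>, by linearity and by the module
  property respectively.
\<close>

lemma ampliation_row_slice_le:
  assumes T: "\<And>x. x \<in> carrier_mat m n \<Longrightarrow> T x = column_map m n A x"
    and K: "0 \<le> K" "map_norm m n T \<le> ennreal K"
    and X: "X \<in> carrier_mat (s * m) (t * n)" "op_norm X \<le> 1"
    and v: "v \<in> carrier_vec (t * n)" and p: "p < m"
  shows "(\<Sum>i<s. (cmod ((ampliation m n s t T X *\<^sub>v v) $ (i * m + p)))\<^sup>2) \<le> (K * l2_norm_vec v)\<^sup>2"
proof -
  define y where "y i = (ampliation m n s t T X *\<^sub>v v) $ (i * m + p)" for i
  define L where "L = sqrt (\<Sum>i<s. (cmod (y i))\<^sup>2)"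
  have L0: "L \<ge> 0" by (simp add: L_def sum_nonneg)
  have L2: "L\<^sup>2 = (\<Sum>i<s. (cmod (y i))\<^sup>2)" by (simp add: L_def sum_nonneg)
  \<comment> \<open>The unit vector that attains the norm \<open>L\<close> of the slice. If \<open>L = 0\<close>, division by zero makes
    it \<open>0\<close>, which is harmless.\<close>
  define c where "c i = cnj (y i) / complex_of_real L" for i
  \<comment> \<open>Polar decomposition \<open>v = W \<rho>\<close>: the partial isometry \<open>W\<close> from \<open>\<complex>\<^sup>n\<close> to \<open>\<complex>\<^sup>t \<otimes> \<complex>\<^sup>n\<close> has diagonal
    blocks with entries \<open>w k j\<close>, so multiplying by it on the right commutes with \<open>T\<close>. It vanishes
    on the coordinates \<open>j\<close> with \<open>\<rho> j = 0\<close>.\<close>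
  define \<rho> where "\<rho> j = sqrt (\<Sum>k<t. (cmod (v $ (k * n + j)))\<^sup>2)" for j
  have \<rho>2: "(\<rho> j)\<^sup>2 = (\<Sum>k<t. (cmod (v $ (k * n + j)))\<^sup>2)" for j
    by (simp add: \<rho>_def sum_nonneg)
  define w where "w k j = v $ (k * n + j) / complex_of_real (\<rho> j)" for k j
  have w_\<rho>: "w k j * complex_of_real (\<rho> j) = v $ (k * n + j)" if "k < t" for k j
  proof (cases "\<rho> j = 0")
    case True
    then have "\<forall>k\<in>{..<t}. (cmod (v $ (k * n + j)))\<^sup>2 = 0"
      using \<rho>2[of j] by (subst sum_nonneg_eq_0_iff[symmetric]) auto
    then show ?thesis using that by (simp add: w_def True)
  qed (simp add: w_def)
  have w_le: "(\<Sum>k<t. (cmod (w k j))\<^sup>2) \<le> 1" for j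
    by (cases "\<rho> j = 0")
      (simp_all add: w_def norm_divide power_divide flip: sum_divide_distrib \<rho>2)
  have c_le: "(\<Sum>i<s. (cmod (c i))\<^sup>2) \<le> 1"
    by (cases "L = 0")
      (simp_all add: c_def norm_divide power_divide flip: sum_divide_distrib L2)
  \<comment> \<open>The compression of \<open>X\<close> by \<open>c\<close> on the left and by \<open>W\<close> on the right.\<close>
  define x where "x = mat m n (\<lambda>(q, j). \<Sum>i<s. \<Sum>k<t. c i * X $$ (i * m + q, k * n + j) * w k j)"
  have x: "x \<in> carrier_mat m n" by (simp add: x_def)
  have x_le: "op_norm x \<le> 1"
    unfolding contraction_iff[OF x]
  proof
    fix u :: "complex vec" assume u: "u \<in> carrier_vec n"
    \<comment> \<open>The vector \<open>W u\<close>.\<close>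
    define \<zeta> where "\<zeta> = vec (t * n) (\<lambda>r. w (r div n) (r mod n) * u $ (r mod n))"
    have \<zeta>: "\<zeta> \<in> carrier_vec (t * n)" by (simp add: \<zeta>_def)
    have \<zeta>_idx: "\<zeta> $ (k * n + j) = w k j * u $ j" if "k < t" "j < n" for k j
      using that block_index_less by (simp add: \<zeta>_def)
    have "(l2_norm_vec \<zeta>)\<^sup>2 = (\<Sum>k<t. \<Sum>j<n. (cmod (w k j))\<^sup>2 * (cmod (u $ j))\<^sup>2)"
      unfolding l2_norm_vec_square[OF \<zeta>] sum_lessThan_mult
      by (intro sum.cong refl) (simp add: \<zeta>_idx norm_mult power_mult_distrib)
    also have "\<dots> = (\<Sum>j<n. (\<Sum>k<t. (cmod (w k j))\<^sup>2) * (cmod (u $ j))\<^sup>2)"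
      unfolding sum_distrib_right by (rule sum.swap)
    also have "\<dots> \<le> (\<Sum>j<n. 1 * (cmod (u $ j))\<^sup>2)"
      by (intro sum_mono mult_right_mono w_le) simp
    finally have \<zeta>_le: "(l2_norm_vec \<zeta>)\<^sup>2 \<le> (l2_norm_vec u)\<^sup>2"
      by (simp add: l2_norm_vec_square[OF u])
    have xu: "x *\<^sub>v u \<in> carrier_vec m" and X\<zeta>: "X *\<^sub>v \<zeta> \<in> carrier_vec (s * m)"
      using x u X \<zeta> by simp_all
    have xu_idx: "(x *\<^sub>v u) $ q = (\<Sum>i<s. c i * (X *\<^sub>v \<zeta>) $ (i * m + q))" if q: "q < m" for q
    proof -
      have "(x *\<^sub>v u) $ q
          = (\<Sum>j<n. \<Sum>i<s. \<Sum>k<t. c i * (X $$ (i * m + q, k * n + j) * (w k j * u $ j)))"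
        unfolding index_mult_mat_vec_sum[OF x u q]
        using q by (simp add: x_def sum_distrib_right mult.assoc)
      also have "\<dots> = (\<Sum>i<s. \<Sum>k<t. \<Sum>j<n. c i * (X $$ (i * m + q, k * n + j) * (w k j * u $ j)))"
        by (subst sum.swap) (intro sum.cong refl sum.swap)
      also have "\<dots> = (\<Sum>i<s. c i * (X *\<^sub>v \<zeta>) $ (i * m + q))"
        by (intro sum.cong refl)
          (simp add: index_mult_mat_vec_sum[OF X(1) \<zeta>] block_index_less q sum_lessThan_mult \<zeta>_idx
            sum_distrib_left)
      finally show ?thesis .
    qed
    have "(l2_norm_vec (x *\<^sub>v u))\<^sup>2 = (\<Sum>q<m. (cmod (\<Sum>i<s. c i * (X *\<^sub>v \<zeta>) $ (i * m + q)))\<^sup>2)"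
      unfolding l2_norm_vec_square[OF xu] by (intro sum.cong refl) (simp add: xu_idx)
    also have "\<dots> \<le> (\<Sum>q<m. 1 * (\<Sum>i<s. (cmod ((X *\<^sub>v \<zeta>) $ (i * m + q)))\<^sup>2))"
      by (intro sum_mono order.trans[OF cmod_sum_Cauchy_Schwarz] mult_right_mono c_le sum_nonneg) simp
    also have "\<dots> = (l2_norm_vec (X *\<^sub>v \<zeta>))\<^sup>2"
      unfolding l2_norm_vec_square[OF X\<zeta>] sum_lessThan_mult
      by (simp, rule sum.swap)
    also have "\<dots> \<le> (l2_norm_vec \<zeta>)\<^sup>2"
      using X \<zeta> l2_norm_vec_nonneg by (intro power_mono) (auto simp: contraction_iff)
    finally show "l2_norm_vec (x *\<^sub>v u) \<le> l2_norm_vec u"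
      using \<zeta>_le l2_norm_vec_nonneg by (meson order.trans power2_le_imp_le)
  qed
  define r where "r = vec n (\<lambda>j. complex_of_real (\<rho> j))"
  have r: "r \<in> carrier_vec n" by (simp add: r_def)
  have r_norm: "l2_norm_vec r = l2_norm_vec v"
  proof -
    have "(l2_norm_vec r)\<^sup>2 = (l2_norm_vec v)\<^sup>2"
      unfolding l2_norm_vec_square[OF r] l2_norm_vec_square[OF v] sum_lessThan_mult
      by (subst sum.swap) (simp add: r_def \<rho>2)
    then show ?thesis using l2_norm_vec_nonneg by simp
  qed
  have Yc: "ampliation m n s t T X \<in> carrier_mat (s * m) (t * n)" by (simp add: ampliation_def)
  have Txc: "T x \<in> carrier_mat m n" using T[OF x] by simp
  have Tx_idx: "T x $$ (p, j)
      = (\<Sum>q<m. A j p q * (\<Sum>i<s. \<Sum>k<t. c i * X $$ (i * m + q, k * n + j) * w k j))" if "j < n" for j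
    unfolding T[OF x] using p that by (simp add: column_map_def x_def)
  have "(T x *\<^sub>v r) $ p
      = (\<Sum>j<n. \<Sum>q<m. \<Sum>i<s. \<Sum>k<t. c i * (A j p q * X $$ (i * m + q, k * n + j) * v $ (k * n + j)))"
    unfolding index_mult_mat_vec_sum[OF Txc r p]
    using p by (simp add: Tx_idx r_def sum_distrib_right sum_distrib_left
        w_\<rho>[symmetric] mult_ac)
  also have "\<dots> = (\<Sum>j<n. \<Sum>i<s. \<Sum>k<t. \<Sum>q<m. c i * (A j p q * X $$ (i * m + q, k * n + j) * v $ (k * n + j)))"
    by (rule sum.cong[OF refl], subst sum.swap) (intro sum.cong refl sum.swap)
  also have "\<dots> = (\<Sum>i<s. \<Sum>k<t. \<Sum>j<n. \<Sum>q<m. c i * (A j p q * X $$ (i * m + q, k * n + j) * v $ (k * n + j)))"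
    by (subst sum.swap) (intro sum.cong refl sum.swap)
  also have "\<dots> = (\<Sum>i<s. c i * y i)"
    by (intro sum.cong refl)
      (simp add: y_def index_mult_mat_vec_sum[OF Yc v] block_index_less p sum_lessThan_mult
        index_ampliation[OF _ p _ _ T] sum_distrib_left sum_distrib_right)
  also have "\<dots> = complex_of_real L"
  proof (cases "L = 0")
    case False
    have "(\<Sum>i<s. c i * y i) = (\<Sum>i<s. y i * cnj (y i)) / complex_of_real L"
      by (simp add: c_def sum_divide_distrib mult.commute)
    also have "(\<Sum>i<s. y i * cnj (y i)) = complex_of_real (L\<^sup>2)"
      unfolding L2 by (simp add: complex_norm_square del: of_real_power)
    finally show ?thesis using False by (simp add: power2_eq_square)
  qed (simp add: c_def)
  finally have "L \<le> l2_norm_vec (T x *\<^sub>v r)"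
    using cmod_component_le_l2_norm_vec[OF mult_mat_vec_carrier[OF Txc r] p] L0 by simp
  also have "\<dots> \<le> K * l2_norm_vec v"
    using map_norm_leD[OF K(2,1) x x_le Txc r] r_norm by simp
  finally show ?thesis
    unfolding y_def[symmetric] L2[symmetric] using L0 by (rule power_mono)
qed

text \<open>The factor \<open>\<surd>m\<close> comes from adding the squared norms of \<open>m\<close> slices.\<close>

lemma ampliation_norm_le:
  assumes T: "right_diag_module_map m n T"
    and K: "0 \<le> K" "map_norm m n T \<le> ennreal K"
  shows "ampliation_norm m n s t T \<le> ennreal (sqrt m * K)"
  unfolding ampliation_norm_def map_norm_def
proof (rule SUP_least)
  obtain A where A: "\<And>x. x \<in> carrier_mat m n \<Longrightarrow> T x = column_map m n A x"
    using right_diag_module_map_imp_column_map[OF T] by blast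
  fix X assume "X \<in> {X \<in> carrier_mat (s * m) (t * n). op_norm X \<le> 1}"
  then have X: "X \<in> carrier_mat (s * m) (t * n)" "op_norm X \<le> 1" by auto
  let ?Y = "ampliation m n s t T X"
  have Y: "?Y \<in> carrier_mat (s * m) (t * n)" by (simp add: ampliation_def)
  have "l2_norm_vec (?Y *\<^sub>v v) \<le> sqrt m * K * l2_norm_vec v" if v: "v \<in> carrier_vec (t * n)" for v
  proof (rule power2_le_imp_le)
    have "(l2_norm_vec (?Y *\<^sub>v v))\<^sup>2 = (\<Sum>p<m. \<Sum>i<s. (cmod ((?Y *\<^sub>v v) $ (i * m + p)))\<^sup>2)"
      unfolding l2_norm_vec_square[OF mult_mat_vec_carrier[OF Y v]] sum_lessThan_mult
      by (rule sum.swap)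
    also have "\<dots> \<le> (\<Sum>p<m. (K * l2_norm_vec v)\<^sup>2)"
      using ampliation_row_slice_le[OF A K X v] by (intro sum_mono) simp
    also have "\<dots> = (sqrt m * K * l2_norm_vec v)\<^sup>2" by (simp add: power_mult_distrib)
    finally show "(l2_norm_vec (?Y *\<^sub>v v))\<^sup>2 \<le> (sqrt m * K * l2_norm_vec v)\<^sup>2" .
  qed (use K l2_norm_vec_nonneg in simp)
  then show "op_norm ?Y \<le> ennreal (sqrt m * K)"
    using op_norm_le_iff[OF Y] K by simp
qed

lemma cb_norm_le:
  assumes "right_diag_module_map m n T" "0 \<le> K" "map_norm m n T \<le> ennreal K"
  shows "cb_norm m n T \<le> ennreal (sqrt m * K)"
  unfolding cb_norm_def by (intro SUP_least ampliation_norm_le assms)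

section \<open>The Weyl unitaries\<close>

text \<open>
  For \<open>j = a m + b\<close> with \<open>a, b < m\<close> this is the matrix \<open>S\<^sup>a D\<^sup>b\<close>, where \<open>S\<close> is the cyclic shift
  and \<open>D\<close> is diagonal with entries \<open>\<omega>\<^sup>q\<close>, for \<open>\<omega> = exp(2 \<pi> i / m)\<close>. The arguments after \<open>j\<close> are the
  row and the column.
\<close>

definition weyl :: "nat \<Rightarrow> nat \<Rightarrow> nat \<Rightarrow> nat \<Rightarrow> complex" where
  "weyl m j i q = (if (q + j div m) mod m = i then cis (2 * pi * real (j mod m) / real m) ^ q else 0)"

lemma sum_root_unity_orthogonal:
  assumes "a < m" "b < m"
  shows "(\<Sum>q<m. cis (2 * pi * real a / real m) ^ q * cnj (cis (2 * pi * real b / real m) ^ q))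
    = (if a = b then of_nat m else 0)"
proof -
  let ?w = "\<lambda>a. cis (2 * pi * real a / real m)"
  have m: "m > 0" using assms by simp
  have unit: "z * cnj z = 1" if "cmod z = 1" for z
    using that by (simp flip: complex_norm_square)
  let ?r = "?w a * cnj (?w b)"
  have eq: "(\<Sum>q<m. ?w a ^ q * cnj (?w b ^ q)) = (\<Sum>q<m. ?r ^ q)"
    by (simp add: power_mult_distrib)
  show ?thesis
  proof (cases "a = b")
    case True
    then show ?thesis unfolding eq using unit[of "?w b"] by simp
  next
    case False
    have pow: "?w k ^ m = 1" for k
      using m by (simp add: DeMoivre)
    have "?w a \<noteq> ?w b"
      using bij_betw_roots_unity[OF m] False assms by (auto simp: bij_betw_def inj_on_def)
    moreover have "?w a = ?r * ?w b"
      using unit[of "?w b"] by (simp add: mult.assoc mult.commute[of "cnj _"] del: cis_cnj)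
    ultimately have "?r \<noteq> 1" by (metis mult_1)
    moreover have "?r ^ m = 1" using pow by (simp add: power_mult_distrib flip: complex_cnj_power)
    ultimately show ?thesis unfolding eq using False by (simp add: geometric_sum del: cis_cnj)
  qed
qed

lemma add_mod_cancel:
  assumes "(a::nat) < m" "b < m" "(q + a) mod m = (q + b) mod m"
  shows "a = b"
  using assms cong_add_lcancel_nat[of q a b m] by (simp add: cong_def)

text \<open>
  Orthogonality for the trace inner product. Different shifts \<open>a\<close> have disjoint supports; for
  equal shifts the inner product is the sum of the powers of an \<open>m\<close>-th root of unity.
\<close>

lemma weyl_orthogonal:
  assumes "j < m\<^sup>2" "j' < m\<^sup>2"
  shows "(\<Sum>i<m. \<Sum>q<m. weyl m j i q * cnj (weyl m j' i q)) = (if j = j' then of_nat m else 0)"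
proof -
  have m: "m > 0" using assms by (cases m) auto
  have div: "j div m < m" "j' div m < m"
    using assms by (auto simp: power2_eq_square less_mult_imp_div_less)
  let ?w = "\<lambda>j. cis (2 * pi * real (j mod m) / real m)"
  have "(\<Sum>i<m. \<Sum>q<m. weyl m j i q * cnj (weyl m j' i q))
      = (\<Sum>q<m. \<Sum>i<m. weyl m j i q * cnj (weyl m j' i q))" by (rule sum.swap)
  also have "\<dots> = (\<Sum>q<m. if j div m = j' div m then ?w j ^ q * cnj (?w j' ^ q) else 0)"
  proof (intro sum.cong refl)
    fix q
    have "(\<Sum>i<m. weyl m j i q * cnj (weyl m j' i q))
      = (\<Sum>i<m. if i = (q + j div m) mod m then
          (if j div m = j' div m then ?w j ^ q * cnj (?w j' ^ q) else 0) else 0)"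
      using add_mod_cancel[OF div, of q] by (intro sum.cong refl) (auto simp: weyl_def)
    then show "(\<Sum>i<m. weyl m j i q * cnj (weyl m j' i q))
      = (if j div m = j' div m then ?w j ^ q * cnj (?w j' ^ q) else 0)"
      using m by simp
  qed
  also have "\<dots> = (if j div m = j' div m \<and> j mod m = j' mod m then of_nat m else 0)"
  proof (cases "j div m = j' div m")
    case True
    show ?thesis
      using sum_root_unity_orthogonal[of "j mod m" m "j' mod m"] m by (simp only: True) simp
  qed simp
  also have "j div m = j' div m \<and> j mod m = j' mod m \<longleftrightarrow> j = j'"
    by (metis div_mult_mod_eq)
  finally show ?thesis .
qed

lemma bij_betw_cyclic_shift: "bij_betw (\<lambda>q. (q + a) mod m) {..<m} {..<m :: nat}"
proof (cases "m = 0")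
  case False
  have "inj_on (\<lambda>q. (q + a) mod m) {..<m}"
    using cong_add_rcancel_nat[of _ a _ m] by (auto intro!: inj_onI simp: cong_def)
  moreover have "(\<lambda>q. (q + a) mod m) ` {..<m} \<subseteq> {..<m}" using False by auto
  ultimately show ?thesis
    by (simp add: bij_betw_def endo_inj_surj)
qed (simp add: bij_betw_def)

lemma weyl_shift:
  assumes "q < m" "q' < m"
  shows "weyl m j ((q + j div m) mod m) q' 
    = (if q' = q then cis (2 * pi * real (j mod m) / real m) ^ q else 0)"
proof -
  have "(q' + j div m) mod m = (q + j div m) mod m \<longleftrightarrow> q' = q"
    using inj_on_eq_iff[OF bij_betw_imp_inj_on[OF bij_betw_cyclic_shift]] assms by auto
  then show ?thesis by (simp add: weyl_def)
qed

lemma weyl_isometry: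
  "(\<Sum>i<m. (cmod (\<Sum>q<m. weyl m j i q * y q))\<^sup>2) = (\<Sum>q<m. (cmod (y q))\<^sup>2)"
proof -
  have "(\<Sum>i<m. (cmod (\<Sum>q<m. weyl m j i q * y q))\<^sup>2)
      = (\<Sum>q<m. (cmod (\<Sum>q'<m. weyl m j ((q + j div m) mod m) q' * y q'))\<^sup>2)"
    by (rule sum.reindex_bij_betw[OF bij_betw_cyclic_shift, symmetric])
  also have "\<dots> = (\<Sum>q<m. (cmod (y q))\<^sup>2)"
  proof (intro sum.cong refl)
    fix q assume "q \<in> {..<m}"
    then have "(\<Sum>q'<m. weyl m j ((q + j div m) mod m) q' * y q')
        = (\<Sum>q'<m. if q' = q then cis (2 * pi * real (j mod m) / real m) ^ q * y q else 0)"
      by (intro sum.cong refl) (simp add: weyl_shift)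
    also have "\<dots> = cis (2 * pi * real (j mod m) / real m) ^ q * y q"
      using \<open>q \<in> {..<m}\<close> by simp
    finally show "(cmod (\<Sum>q'<m. weyl m j ((q + j div m) mod m) q' * y q'))\<^sup>2 = (cmod (y q))\<^sup>2"
      by (simp add: norm_mult norm_power)
  qed
  finally show ?thesis .
qed

lemma weyl_rows_orthonormal:
  assumes "p < m" "k < m"
  shows "(\<Sum>q<m. weyl m j p q * cnj (weyl m j k q)) = (if p = k then 1 else 0)"
proof -
  let ?w = "cis (2 * pi * real (j mod m) / real m)"
  have unit: "?w ^ q * cnj (?w ^ q) = 1" for q
    unfolding complex_norm_square[symmetric] by (simp add: norm_power)
  have "(\<Sum>q<m. weyl m j p q * cnj (weyl m j k q))
      = (\<Sum>q<m. if p = (q + j div m) mod m then (if p = k then 1 else 0) else 0)"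
    by (intro sum.cong refl) (use unit in \<open>auto simp: weyl_def\<close>)
  also have "\<dots> = (\<Sum>q<m. if p = q then (if p = k then 1 else 0) else 0)"
    by (rule sum.reindex_bij_betw[OF bij_betw_cyclic_shift,
          where g = "\<lambda>i. if p = i then (if p = k then 1 else 0) else 0"])
  finally show ?thesis using assms by simp
qed

section \<open>The extremal map\<close>

text \<open>
  The factor \<open>c\<close> lets one pair of estimates serve both the extremal map (\<open>c = 1\<close>) and its
  multiple of norm at most \<open>1\<close> (\<open>c = 1 / \<surd>m\<close>), which gives the lower bound for \<open>C(m, m\<^sup>2)\<close>.
\<close>

definition weyl_map :: "real \<Rightarrow> nat \<Rightarrow> complex mat \<Rightarrow> complex mat" where
  "weyl_map c m = column_map m (m\<^sup>2) (\<lambda>j i q. complex_of_real c * weyl m j i q)"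

text \<open>
  The operator norm is at most the Hilbert-Schmidt norm, which the Weyl unitaries preserve column
  by column, and a contraction with \<open>m\<close> rows has Hilbert-Schmidt norm at most \<open>\<surd>m\<close>.
\<close>

lemma map_norm_weyl_map_le:
  assumes "0 \<le> c"
  shows "map_norm m (m\<^sup>2) (weyl_map c m) \<le> ennreal (c * sqrt m)"
  unfolding map_norm_def
proof (rule SUP_least)
  fix x assume "x \<in> {x \<in> carrier_mat m (m\<^sup>2). op_norm x \<le> 1}"
  then have x: "x \<in> carrier_mat m (m\<^sup>2)" "op_norm x \<le> 1" by auto
  let ?Y = "weyl_map c m x"
  have Y: "?Y \<in> carrier_mat m (m\<^sup>2)" by (simp add: weyl_map_def)
  have Y_idx: "?Y $$ (i, j) = complex_of_real c * (\<Sum>q<m. weyl m j i q * x $$ (q, j))"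
    if "i < m" "j < m\<^sup>2" for i j
    using that by (simp add: weyl_map_def column_map_def sum_distrib_left mult.assoc)
  have "(\<Sum>i<m. \<Sum>j<m\<^sup>2. (cmod (?Y $$ (i, j)))\<^sup>2)
      = (\<Sum>j<m\<^sup>2. \<Sum>i<m. c\<^sup>2 * (cmod (\<Sum>q<m. weyl m j i q * x $$ (q, j)))\<^sup>2)"
    by (subst sum.swap) (intro sum.cong refl, simp add: Y_idx norm_mult power_mult_distrib)
  also have "\<dots> = (\<Sum>j<m\<^sup>2. \<Sum>q<m. c\<^sup>2 * (cmod (x $$ (q, j)))\<^sup>2)"
    by (simp add: weyl_isometry flip: sum_distrib_left)
  also have "\<dots> = (\<Sum>q<m. c\<^sup>2 * (\<Sum>j<m\<^sup>2. (cmod (x $$ (q, j)))\<^sup>2))"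
    unfolding sum_distrib_left by (rule sum.swap)
  also have "\<dots> \<le> (\<Sum>q<m. c\<^sup>2 * 1)"
    by (intro sum_mono mult_left_mono contraction_row_le_1[OF x]) auto
  also have "\<dots> = (c * sqrt m)\<^sup>2" by (simp add: power_mult_distrib)
  finally have HS: "(\<Sum>i<m. \<Sum>j<m\<^sup>2. (cmod (?Y $$ (i, j)))\<^sup>2) \<le> (c * sqrt m)\<^sup>2" .
  have "l2_norm_vec (?Y *\<^sub>v v) \<le> c * sqrt m * l2_norm_vec v" if v: "v \<in> carrier_vec (m\<^sup>2)" for v
  proof (rule power2_le_imp_le)
    have "(l2_norm_vec (?Y *\<^sub>v v))\<^sup>2 = (\<Sum>i<m. (cmod (\<Sum>j<m\<^sup>2. ?Y $$ (i, j) * v $ j))\<^sup>2)"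
      unfolding l2_norm_vec_square[OF mult_mat_vec_carrier[OF Y v]]
      by (simp add: index_mult_mat_vec_sum[OF Y v])
    also have "\<dots> \<le> (\<Sum>i<m. (\<Sum>j<m\<^sup>2. (cmod (?Y $$ (i, j)))\<^sup>2) * (l2_norm_vec v)\<^sup>2)"
      unfolding l2_norm_vec_square[OF v] by (intro sum_mono cmod_sum_Cauchy_Schwarz)
    also have "\<dots> \<le> (c * sqrt m)\<^sup>2 * (l2_norm_vec v)\<^sup>2"
      unfolding sum_distrib_right[symmetric] by (intro mult_right_mono HS) simp
    finally show "(l2_norm_vec (?Y *\<^sub>v v))\<^sup>2 \<le> (c * sqrt m * l2_norm_vec v)\<^sup>2"
      by (simp add: power_mult_distrib)
  qed (use assms l2_norm_vec_nonneg in simp)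
  then show "op_norm ?Y \<le> ennreal (c * sqrt m)"
    using op_norm_le_iff[OF Y] assms by simp
qed

text \<open>
  The witness is the unitary whose columns are the vectors \<open>(I \<otimes> U\<^sub>j\<^sup>*) \<Omega>\<close>. The ampliation sends
  every column to \<open>c \<Omega>\<close>.
\<close>

lemma ampliation_norm_weyl_map_ge:
  assumes "0 \<le> c" and m: "m > 0"
  shows "ennreal (c * real m) \<le> ampliation_norm m (m\<^sup>2) m 1 (weyl_map c m)"
proof -
  \<comment> \<open>Since \<open>\<Omega>\<close> has the coordinates \<open>1 / \<surd>m\<close> at the diagonal positions \<open>(k, k)\<close>, the coordinate
    of \<open>(I \<otimes> U\<^sub>j\<^sup>*) \<Omega>\<close> at \<open>(k, q)\<close> is the conjugate of \<open>weyl m j k q\<close> divided by \<open>\<surd>m\<close>.\<close>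
  define Z where "Z = mat (m * m) (1 * m\<^sup>2)
    (\<lambda>(r, j). cnj (weyl m j (r div m) (r mod m)) / complex_of_real (sqrt m))"
  have Z: "Z \<in> carrier_mat (m * m) (1 * m\<^sup>2)" by (simp add: Z_def)
  have Z_idx: "Z $$ (k * m + q, j) = cnj (weyl m j k q) / complex_of_real (sqrt m)"
    if "k < m" "q < m" "j < m\<^sup>2" for k q j
    using that block_index_less by (simp add: Z_def)
  have sqrt2: "complex_of_real (sqrt m) * complex_of_real (sqrt m) = of_nat m"
    by (simp flip: of_real_mult)
  have Z_le: "op_norm Z \<le> 1"
  proof (rule contraction_of_orthonormal_cols[OF Z])
    fix j j' assume "j < 1 * m\<^sup>2" "j' < 1 * m\<^sup>2"
    then have jj: "j < m\<^sup>2" "j' < m\<^sup>2" by simp_all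
    have "(\<Sum>r<m * m. Z $$ (r, j) * cnj (Z $$ (r, j')))
        = (\<Sum>k<m. \<Sum>q<m. weyl m j' k q * cnj (weyl m j k q)) / of_nat m"
      unfolding sum_lessThan_mult sum_divide_distrib
      by (intro sum.cong refl) (simp add: Z_idx jj sqrt2 mult.commute)
    then show "(\<Sum>r<m * m. Z $$ (r, j) * cnj (Z $$ (r, j'))) = (if j = j' then 1 else 0)"
      using weyl_orthogonal[OF jj(2,1)] m by (cases "j = j'") auto
  qed
  define Y where "Y = ampliation m (m\<^sup>2) m 1 (weyl_map c m) Z"
  have Y: "Y \<in> carrier_mat (m * m) (1 * m\<^sup>2)" by (simp add: Y_def ampliation_def)
  have Y_idx: "Y $$ (k * m + p, j) = (if p = k then complex_of_real (c / sqrt m) else 0)"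
    if "k < m" "p < m" "j < m\<^sup>2" for k p j
  proof -
    have "Y $$ (k * m + p, 0 * m\<^sup>2 + j)
        = (\<Sum>q<m. complex_of_real c * weyl m j p q * Z $$ (k * m + q, 0 * m\<^sup>2 + j))"
      unfolding Y_def by (rule index_ampliation) (use that in \<open>auto simp: weyl_map_def\<close>)
    also have "\<dots> = complex_of_real c / complex_of_real (sqrt m)
        * (\<Sum>q<m. weyl m j p q * cnj (weyl m j k q))"
      unfolding sum_distrib_left using that by (intro sum.cong refl) (simp add: Z_idx)
    finally show ?thesis using that by (simp add: weyl_rows_orthonormal)
  qed
  \<comment> \<open>The unit vector with \<open>m\<^sup>2\<close> equal coordinates adds the equal columns with no cancellation.\<close>
  define v where "v = vec (1 * m\<^sup>2) (\<lambda>_. complex_of_real (1 / m))"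
  have v: "v \<in> carrier_vec (1 * m\<^sup>2)" by (simp add: v_def)
  have "(l2_norm_vec v)\<^sup>2 = 1\<^sup>2"
    unfolding l2_norm_vec_square[OF v] using m by (simp add: v_def norm_divide power_divide)
  then have v_norm: "l2_norm_vec v = 1"
    using l2_norm_vec_nonneg by (metis power2_eq_imp_eq zero_le_one)
  have Yv: "(Y *\<^sub>v v) $ (k * m + p) = (if p = k then complex_of_real (c * sqrt m) else 0)"
    if "k < m" "p < m" for k p
  proof -
    have "(Y *\<^sub>v v) $ (k * m + p)
        = (\<Sum>j<m\<^sup>2. if p = k then complex_of_real (c / sqrt m) * complex_of_real (1 / m) else 0)"
      unfolding index_mult_mat_vec_sum[OF Y v block_index_less[OF that]]
      using that by (intro sum.cong) (auto simp: Y_idx v_def)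
    also have "\<dots> = (if p = k then complex_of_real (real (m\<^sup>2) * (c / sqrt m * (1 / m))) else 0)"
      by simp
    also have "real (m\<^sup>2) * (c / sqrt m * (1 / m)) = c * sqrt m"
      using m by (simp add: power2_eq_square real_div_sqrt field_simps flip: real_sqrt_mult)
    finally show ?thesis .
  qed
  have "(l2_norm_vec (Y *\<^sub>v v))\<^sup>2 = (\<Sum>k<m. \<Sum>p<m. if p = k then (c * sqrt m)\<^sup>2 else 0)"
    unfolding l2_norm_vec_square[OF mult_mat_vec_carrier[OF Y v]] sum_lessThan_mult
    using assms by (intro sum.cong refl) (simp add: Yv norm_mult)
  also have "\<dots> = (c * real m)\<^sup>2"
    by (simp add: power_mult_distrib power2_eq_square)
  finally have "l2_norm_vec (Y *\<^sub>v v) = c * real m"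
    using assms l2_norm_vec_nonneg by (simp add: power2_eq_iff_nonneg)
  then have "ennreal (c * real m) \<le> op_norm Y"
    unfolding op_norm_def using v v_norm Y by (intro SUP_upper2[of v]) auto
  also have "\<dots> \<le> ampliation_norm m (m\<^sup>2) m 1 (weyl_map c m)"
    unfolding ampliation_norm_def map_norm_def Y_def using Z Z_le by (intro SUP_upper) auto
  finally show ?thesis .
qed

lemma right_diag_module_map_weyl_map: "right_diag_module_map m (m\<^sup>2) (weyl_map c m)"
  unfolding weyl_map_def by (rule right_diag_module_map_column_map)

lemma ampliation_norm_le_cb_norm:
  assumes "1 \<le> s" "1 \<le> t"
  shows "ampliation_norm m n s t T \<le> cb_norm m n T"
  unfolding cb_norm_def using assms by (intro SUP_upper2[of s] SUP_upper) auto

section \<open>The value of the constant\<close>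

theorem theorem6p3:
  fixes m :: nat
  assumes "m > 1"
  shows "(\<exists>T. right_diag_module_map m (m\<^sup>2) T \<and>
            ennreal (sqrt (real m)) = map_norm m (m\<^sup>2) T \<and>
            map_norm m (m\<^sup>2) T < ampliation_norm m (m\<^sup>2) m 1 T \<and>
            ampliation_norm m (m\<^sup>2) m 1 T = cb_norm m (m\<^sup>2) T \<and>
            cb_norm m (m\<^sup>2) T = ennreal (real m)) \<and>
         C_const m (m\<^sup>2) = ennreal (sqrt (real m))"
proof -
  let ?T = "weyl_map 1 m" and ?S = "weyl_map (1 / sqrt m) m"
  note mod = right_diag_module_map_weyl_map
  have le: "map_norm m (m\<^sup>2) ?T \<le> ennreal (sqrt m)"
    using map_norm_weyl_map_le[of 1 m] by simp
  have "cb_norm m (m\<^sup>2) ?T \<le> ennreal m"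
    using cb_norm_le[OF mod _ le] by simp
  moreover have "ennreal m \<le> ampliation_norm m (m\<^sup>2) m 1 ?T"
    using ampliation_norm_weyl_map_ge[of 1 m] assms by simp
  moreover have "ampliation_norm m (m\<^sup>2) m 1 ?T \<le> cb_norm m (m\<^sup>2) ?T"
    using assms by (intro ampliation_norm_le_cb_norm) auto
  ultimately have cb: "cb_norm m (m\<^sup>2) ?T = ennreal m"
    and ampl: "ampliation_norm m (m\<^sup>2) m 1 ?T = ennreal m"
    by auto
  \<comment> \<open>A smaller norm \<open>K\<close> would give a completely bounded norm of at most \<open>\<surd>m K < m\<close>.\<close>
  have "ennreal (sqrt m) \<le> map_norm m (m\<^sup>2) ?T"
  proof -
    obtain K where K: "0 \<le> K" "map_norm m (m\<^sup>2) ?T = ennreal K"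
      using le by (cases "map_norm m (m\<^sup>2) ?T") (auto simp: top_unique)
    have "ennreal (sqrt m * sqrt m) \<le> ennreal (sqrt m * K)"
      using cb_norm_le[OF mod K(1), of m 1] K(2) cb by simp
    then have "sqrt m * sqrt m \<le> sqrt m * K"
      using K(1) by (subst (asm) ennreal_le_iff) auto
    then have "sqrt m \<le> K"
      by (rule mult_left_le_imp_le) (use assms in simp)
    then show ?thesis using K by (simp add: ennreal_leI)
  qed
  with le have norm: "map_norm m (m\<^sup>2) ?T = ennreal (sqrt m)" by simp
  have "sqrt m < real m"
    using assms by (simp add: real_less_lsqrt power2_eq_square)
  then have less: "map_norm m (m\<^sup>2) ?T < ampliation_norm m (m\<^sup>2) m 1 ?T"
    unfolding norm ampl by (simp add: ennreal_less_iff)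
  have C_le: "C_const m (m\<^sup>2) \<le> ennreal (sqrt m)"
    unfolding C_const_def
  proof (rule SUP_least)
    fix T assume "T \<in> {T. right_diag_module_map m (m\<^sup>2) T \<and> map_norm m (m\<^sup>2) T \<le> 1}"
    then show "cb_norm m (m\<^sup>2) T \<le> ennreal (sqrt m)"
      using cb_norm_le[of m "m\<^sup>2" T 1] by simp
  qed
  have "map_norm m (m\<^sup>2) ?S \<le> 1"
    using map_norm_weyl_map_le[of "1 / sqrt m" m] assms by simp
  then have "cb_norm m (m\<^sup>2) ?S \<le> C_const m (m\<^sup>2)"
    unfolding C_const_def using mod by (intro SUP_upper) auto
  moreover have "ennreal (sqrt m) \<le> ampliation_norm m (m\<^sup>2) m 1 ?S"
    using ampliation_norm_weyl_map_ge[of "1 / sqrt m" m] assms by (simp add: real_div_sqrt)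
  moreover have "ampliation_norm m (m\<^sup>2) m 1 ?S \<le> cb_norm m (m\<^sup>2) ?S"
    using assms by (intro ampliation_norm_le_cb_norm) auto
  ultimately have "C_const m (m\<^sup>2) = ennreal (sqrt m)"
    using C_le by (meson order.antisym order.trans)
  then show ?thesis
    using mod[of m 1] norm less cb ampl by (intro conjI exI[of _ ?T]) auto
qed

end
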